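(* Let $n \geq 1$ and let $\varphi$ be a Boolean formula in Precise Conjunctive Normal Form whose variables are among a set of $n$ variables. If $\varphi$ has more than $g(n) = \sum_{i=1}^{n} 2^{i}\binom{n}{i} - \sum_{i=1}^{n}\binom{n}{i} - \sum_{i=0}^{n-1}\binom{n-1}{i}$ $(=3^n-2^n-2^{n-1})$ clauses, then $\varphi$ has either a unique satisfying truth assignment (to these $n$ variables) or no satisfying truth assignment.
   Context: A literal is a variable $x$ or its complement $\sim x$. A clause is a (nonempty) disjunction of literals; a formula in conjunctive normal form is a conjunction of clauses. A Boolean formula is in Precise Conjunctive Normal Form (PCNF) if it is a conjunction of pairwise distinct clauses, where each clause is a disjunction of pairwise distinct literals and no clause contains both a variable and its complement. Clauses are identified as sets of literals. A truth assignment satisfies the formula if it makes every clause true. *)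

theory Defs
  imports Main "HOL-Library.FuncSet"
begin

datatype 'v literal = Pos 'v | Neg 'v

primrec lit_var :: "'v literal \<Rightarrow> 'v" where
  "lit_var (Pos x) = x"
| "lit_var (Neg x) = x"

type_synonym 'v clause = "'v literal list"
type_synonym 'v cnf = "'v clause list"

definition vars :: "'v cnf \<Rightarrow> 'v set" where
  "vars \<phi> = (\<Union>C\<in>set \<phi>. lit_var ` set C)"

text \<open>
  A clause is written as a list of literals but identified with its set of literals.
  Hence distinctness of clauses is required of these sets: two clauses that differ
  only in the order of their literals count as equal.
\<close>

definition pcnf :: "'v cnf \<Rightarrow> bool" where
  "pcnf \<phi> \<longleftrightarrow> distinct (map set \<phi>) \<and>
     (\<forall>C\<in>set \<phi>. C \<noteq> [] \<and> distinct C \<and> (\<nexists>x. Pos x \<in> set C \<and> Neg x \<in> set C))"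

primrec lit_true :: "('v \<Rightarrow> bool) \<Rightarrow> 'v literal \<Rightarrow> bool" where
  "lit_true \<alpha> (Pos x) \<longleftrightarrow> \<alpha> x"
| "lit_true \<alpha> (Neg x) \<longleftrightarrow> \<not> \<alpha> x"

definition satisfies :: "('v \<Rightarrow> bool) \<Rightarrow> 'v cnf \<Rightarrow> bool" where
  "satisfies \<alpha> \<phi> \<longleftrightarrow> (\<forall>C\<in>set \<phi>. \<exists>l\<in>set C. lit_true \<alpha> l)"

text \<open>
  Truth assignments to a set of variables are extensional functions, so that each
  map from these variables to the truth values is represented exactly once; otherwise
  values at other variables would destroy uniqueness.
\<close>

definition assignments :: "'v set \<Rightarrow> ('v \<Rightarrow> bool) set" where
  "assignments V = V \<rightarrow>\<^sub>E UNIV"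

text \<open>The value is an integer so that the subtractions are not truncated.\<close>

definition g :: "nat \<Rightarrow> int" where
  "g n = (\<Sum>i=1..n. 2 ^ i * int (n choose i)) - (\<Sum>i=1..n. int (n choose i))
         - (\<Sum>i=0..n-1. int ((n - 1) choose i))"

end

theory Submission
  imports Defs
begin

text \<open>
  There are \<open>3 ^ n\<close> consistent literal sets over \<open>n\<close> variables, the empty one included. An
  assignment falsifies \<open>2 ^ n\<close> of them. If two assignments \<open>\<alpha>\<close> and \<open>\<beta>\<close> differ at \<open>x\<close>, then the
  \<open>2 ^ (n - 1)\<close> sets falsified by \<open>\<beta>\<close> that mention \<open>x\<close> are all true under \<open>\<alpha>\<close>. So at least
  \<open>2 ^ n + 2 ^ (n - 1)\<close> consistent sets are falsified by one of the two, and none of these is a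
  clause of a formula that both satisfy.
\<close>

lemma g_eq:
  assumes "n \<ge> 1"
  shows "g n = 3 ^ n - 2 ^ n - 2 ^ (n - 1)"
proof -
  \<comment> \<open>The binomial theorem and the row sum start at index 0. Both sums of
    \<open>g\<close> that start at 1 lack a term equal to 1 there, and these cancel in the
    difference.\<close>
  have drop0: "(\<Sum>i=1..n. f i) = (\<Sum>i\<le>n. f i) - f 0" for f :: "nat \<Rightarrow> int"
    using sum.atLeast_Suc_atMost[of 0 n f] by (simp add: atMost_atLeast0)
  have "(\<Sum>i\<le>n. 2 ^ i * int (n choose i)) = 3 ^ n"
    using binomial_ring[of "2::int" 1 n] by (simp add: mult.commute)
  moreover have "(\<Sum>i\<le>m. int (m choose i)) = 2 ^ m" for m
    using arg_cong[OF choose_row_sum[of m], of int] by simp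
  ultimately show ?thesis
    unfolding g_def drop0 by (simp flip: atMost_atLeast0)
qed

definition consistent_sets :: "'v set \<Rightarrow> 'v literal set set" where
  "consistent_sets V = {S. lit_var ` S \<subseteq> V \<and> (\<nexists>x. Pos x \<in> S \<and> Neg x \<in> S)}"

text \<open>Each variable of \<open>V\<close> occurs positively, negatively or not at all;
  consistency rules out the pair \<open>(True, True)\<close>. An injection into these choices gives
  both claims.\<close>

lemma consistent_sets_finite_card_le:
  assumes "finite V"
  shows "finite (consistent_sets V)" and "card (consistent_sets V) \<le> 3 ^ card V"
proof -
  let ?T = "V \<rightarrow>\<^sub>E {(True, False), (False, True), (False, False)}"
  let ?f = "\<lambda>S. \<lambda>x\<in>V. (Pos x \<in> S, Neg x \<in> S)"
  have inj: "inj_on ?f (consistent_sets V)"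
  proof (rule inj_onI)
    fix S T
    assume S: "S \<in> consistent_sets V" and T: "T \<in> consistent_sets V" and eq: "?f S = ?f T"
    have mem: "Pos x \<in> S \<longleftrightarrow> Pos x \<in> T" "Neg x \<in> S \<longleftrightarrow> Neg x \<in> T" if "x \<in> V" for x
      using fun_cong[OF eq, of x] that by simp_all
    have "l \<in> S \<longleftrightarrow> l \<in> T" for l
    proof (cases "lit_var l \<in> V")
      case True
      then show ?thesis by (cases l) (simp_all add: mem)
    next
      \<comment> \<open>The encoding records nothing outside \<open>V\<close>, but neither set has a
        literal there.\<close>
      case False
      then show ?thesis using S T by (auto simp: consistent_sets_def)
    qed
    then show "S = T" by blast
  qed
  have sub: "?f ` consistent_sets V \<subseteq> ?T"
    by (auto simp: consistent_sets_def)
  have fin: "finite ?T"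
    using assms by (simp add: finite_PiE)
  show "finite (consistent_sets V)"
    using inj sub fin by (rule inj_on_finite)
  have "card (consistent_sets V) \<le> card ?T"
    using inj sub fin by (rule card_inj_on_le)
  also have "\<dots> = 3 ^ card V"
    using assms by (simp add: card_PiE numeral_3_eq_3)
  finally show "card (consistent_sets V) \<le> 3 ^ card V" .
qed

text \<open>The literal sets over \<open>V\<close> that \<alpha> falsifies are exactly the images of
  the subsets of \<open>V\<close> under this map, which makes them easy to count.\<close>

definition false_lit :: "('v \<Rightarrow> bool) \<Rightarrow> 'v \<Rightarrow> 'v literal" where
  "false_lit \<alpha> x = (if \<alpha> x then Neg x else Pos x)"

lemma lit_var_false_lit [simp]: "lit_var (false_lit \<alpha> x) = x"
  by (simp add: false_lit_def)

lemma not_lit_true_false_lit [simp]: "\<not> lit_true \<alpha> (false_lit \<alpha> x)"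
  by (simp add: false_lit_def)

lemma lit_true_false_lit_iff: "lit_true \<alpha> (false_lit \<beta> x) \<longleftrightarrow> \<alpha> x \<noteq> \<beta> x"
  by (simp add: false_lit_def)

lemma inj_image_false_lit: "inj ((`) (false_lit \<alpha>))"
  by (rule inj_on_image, rule inj_on_inverseI[where g = lit_var]) simp

lemma false_lit_image_consistent:
  assumes "A \<subseteq> V"
  shows "false_lit \<alpha> ` A \<in> consistent_sets V"
  using assms by (auto simp: consistent_sets_def false_lit_def split: if_splits)

lemma card_two_satisfied_le:
  assumes V: "finite V" and sub: "\<C> \<subseteq> consistent_sets V"
    and sat: "\<And>S. S \<in> \<C> \<Longrightarrow> (\<exists>l\<in>S. lit_true \<alpha> l) \<and> (\<exists>l\<in>S. lit_true \<beta> l)"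
    and x: "x \<in> V" "\<alpha> x \<noteq> \<beta> x"
  shows "card \<C> + 2 ^ card V + 2 ^ (card V - 1) \<le> 3 ^ card V"
proof -
  define A where "A = (`) (false_lit \<alpha>) ` Pow V"
  \<comment> \<open>Each member contains \<open>false_lit \<beta> x\<close>, which is true under
    \<alpha>; this keeps \<open>B\<close> disjoint from \<open>A\<close>.\<close>
  define B where "B = (`) (false_lit \<beta>) ` insert x ` Pow (V - {x})"
  have fin: "finite \<C>" "finite A" "finite B"
    using V sub consistent_sets_finite_card_le(1)[OF V]
    by (auto simp: A_def B_def dest: finite_subset)
  have cA: "card A = 2 ^ card V"
    unfolding A_def using V inj_on_subset[OF inj_image_false_lit]
    by (subst card_image) (auto simp: card_Pow)
  \<comment> \<open>Injectivity depends on taking \<open>x\<close> out of \<open>V\<close> first,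
    whence the exponent \<open>card V - 1\<close>.\<close>
  have "inj_on (insert x) (Pow (V - {x}))"
    by (rule inj_onI) blast
  then have cB: "card B = 2 ^ (card V - 1)"
    unfolding B_def using V x(1) inj_on_subset[OF inj_image_false_lit]
    by (subst card_image, blast, subst card_image) (auto simp: card_Pow)
  have falsA: "\<not> (\<exists>l\<in>S. lit_true \<alpha> l)" if "S \<in> A" for S
    using that by (auto simp: A_def)
  have falsB: "\<not> (\<exists>l\<in>S. lit_true \<beta> l)" if "S \<in> B" for S
    using that by (auto simp: B_def)
  have trueB: "\<exists>l\<in>S. lit_true \<alpha> l" if "S \<in> B" for S
    using that x(2) by (auto simp: B_def lit_true_false_lit_iff)
  have "A \<inter> B = {}" "\<C> \<inter> (A \<union> B) = {}"
    using falsA falsB trueB sat by blast+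
  then have "card \<C> + (card A + card B) = card (\<C> \<union> (A \<union> B))"
    using fin by (simp add: card_Un_disjoint)
  also have "\<dots> \<le> card (consistent_sets V)"
  proof (rule card_mono[OF consistent_sets_finite_card_le(1)[OF V]])
    have "A \<subseteq> consistent_sets V" "B \<subseteq> consistent_sets V"
      unfolding A_def B_def using x(1) by (auto intro!: false_lit_image_consistent)
    then show "\<C> \<union> (A \<union> B) \<subseteq> consistent_sets V"
      using sub by blast
  qed
  also have "\<dots> \<le> 3 ^ card V"
    by (rule consistent_sets_finite_card_le(2)[OF V])
  finally show ?thesis by (simp add: cA cB)
qed

lemma pcnf_length_le:
  assumes V: "finite V" and pcnf: "pcnf \<phi>" and vars: "vars \<phi> \<subseteq> V"
    and \<alpha>: "\<alpha> \<in> assignments V" "satisfies \<alpha> \<phi>"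
    and \<beta>: "\<beta> \<in> assignments V" "satisfies \<beta> \<phi>"
    and "\<alpha> \<noteq> \<beta>"
  shows "length \<phi> + 2 ^ card V + 2 ^ (card V - 1) \<le> 3 ^ card V"
proof -
  \<comment> \<open>Extensional functions agree outside \<open>V\<close>, so a difference must occur
    inside it.\<close>
  obtain x where x: "x \<in> V" "\<alpha> x \<noteq> \<beta> x"
    using \<alpha>(1) \<beta>(1) \<open>\<alpha> \<noteq> \<beta>\<close> PiE_ext[of \<alpha> V _ \<beta>] unfolding assignments_def by blast
  \<comment> \<open>Distinctness of the literal sets, not just of the lists, lets the length count
    sets.\<close>
  have "length \<phi> = card (set ` set \<phi>)"
    using pcnf distinct_card[of "map set \<phi>"] by (simp add: pcnf_def)
  moreover have "set ` set \<phi> \<subseteq> consistent_sets V"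
    using pcnf vars by (fastforce simp: consistent_sets_def pcnf_def vars_def)
  moreover have "(\<exists>l\<in>S. lit_true \<alpha> l) \<and> (\<exists>l\<in>S. lit_true \<beta> l)" if "S \<in> set ` set \<phi>" for S
    using \<alpha>(2) \<beta>(2) that unfolding satisfies_def by blast
  ultimately show ?thesis
    using card_two_satisfied_le[where \<alpha> = \<alpha> and \<beta> = \<beta>, OF V _ _ x, of "set ` set \<phi>"] by simp
qed

theorem theorem3:
  fixes n :: nat
  assumes "n \<ge> 1"
  shows "g n = 3 ^ n - 2 ^ n - 2 ^ (n - 1) \<and>
    (\<forall>(V :: 'v set) \<phi>.
       finite V \<longrightarrow> card V = n \<longrightarrow> pcnf \<phi> \<longrightarrow> vars \<phi> \<subseteq> V \<longrightarrow> int (length \<phi>) > g n \<longrightarrow>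
         (\<exists>!\<alpha>. \<alpha> \<in> assignments V \<and> satisfies \<alpha> \<phi>) \<or>
         \<not> (\<exists>\<alpha>. \<alpha> \<in> assignments V \<and> satisfies \<alpha> \<phi>))"
proof (intro conjI allI impI)
  show g: "g n = 3 ^ n - 2 ^ n - 2 ^ (n - 1)"
    using assms by (rule g_eq)
  fix V :: "'v set" and \<phi>
  assume V: "finite V" "card V = n" and \<phi>: "pcnf \<phi>" "vars \<phi> \<subseteq> V"
    and len: "int (length \<phi>) > g n"
  \<comment> \<open>The disjunction amounts to at most one satisfying assignment.\<close>
  have "\<alpha> = \<beta>" if "\<alpha> \<in> assignments V \<and> satisfies \<alpha> \<phi>" "\<beta> \<in> assignments V \<and> satisfies \<beta> \<phi>"
    for \<alpha> \<beta>
  proof (rule ccontr)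
    assume "\<alpha> \<noteq> \<beta>"
    then have "length \<phi> + 2 ^ n + 2 ^ (n - 1) \<le> 3 ^ n"
      using pcnf_length_le[OF V(1) \<phi>] that V(2) by blast
    then have "int (length \<phi> + 2 ^ n + 2 ^ (n - 1)) \<le> int (3 ^ n)"
      by (rule of_nat_mono)
    then show False using len g by simp
  qed
  then show "(\<exists>!\<alpha>. \<alpha> \<in> assignments V \<and> satisfies \<alpha> \<phi>) \<or>
      \<not> (\<exists>\<alpha>. \<alpha> \<in> assignments V \<and> satisfies \<alpha> \<phi>)"
    by blast
qed

end
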